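(* Let $n$ be a positive integer with at least three (distinct) prime factors. Then $$\mathbb{C}[\mathbf{x}]^{D} = \mathbb{C}[\mathbf{x}]^{\Delta} \supsetneq \mathbb{C}[\Theta_{p}(\mathbf{y}^{(p)}_{i}) \mid p \text{ is a prime factor of } n,\ 0 \leq i \leq n_{p} - 1].$$
   Context: Let $\mathbf{x} = (x_0, \ldots, x_{n-1})$ be variables and $\mathbb{C}[\mathbf{x}] = \mathbb{C}[x_0,\ldots,x_{n-1}]$ the polynomial ring. With the conventions $x_{-1} := x_{n-1}$ and $x_n := x_0$, define the differential operators $$D := \sum_{i=0}^{n-1} x_{i-1}\frac{\partial}{\partial x_i}, \qquad \Delta := \sum_{i=0}^{n-1} x_{i+1}\frac{\partial}{\partial x_i},$$ and $\mathbb{C}[\mathbf{x}]^{D} := \{f \in \mathbb{C}[\mathbf{x}] \mid Df = 0\}$, $\mathbb{C}[\mathbf{x}]^{\Delta} := \{f \in \mathbb{C}[\mathbf{x}] \mid \Delta f = 0\}$. For $m \ge 1$ and elements $u_0,\ldots,u_{m-1}$ of a commutative ring, $\Theta_m(u_0,\ldots,u_{m-1})$ denotes the circulant determinant of order $m$, i.e. the determinant of the $m\times m$ matrix whose $(r,s)$ entry ($0 \le r,s \le m-1$) is $u_{(r-s) \bmod m}$. Let $\zeta_n \in \mathbb{C}$ be a primitive $n$-th root of unity. For a positive divisor $p$ of $n$ put $n_p := n/p$, and for $0 \le i \le n_p - 1$ let $\mathbf{y}^{(p)}_i := (y^{(p)}_{i,0}, \ldots, y^{(p)}_{i,p-1})$,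 where $$y^{(p)}_{i,j} := \sum_{l=0}^{n_p-1} \zeta_n^{i(j+pl)} x_{j+pl} \quad (0 \le j \le p-1).$$ For a family of elements of $\mathbb{C}[\mathbf{x}]$, $\mathbb{C}[\ldots]$ denotes the $\mathbb{C}$-subalgebra of $\mathbb{C}[\mathbf{x}]$ generated by them. *)

theory Defs
  imports
    Complex_Main
    "HOL-Library.Poly_Mapping"
    "HOL-Computational_Algebra.Primes"
    "Jordan_Normal_Form.Determinant"
begin

(* A monomial is a finitely supported exponent function, a polynomial a finitely supported
   coefficient function on monomials; multiplication is convolution. Variables are indexed by
   nat, so the ring in n variables is the subset poly_ring n below. *)
type_synonym cpoly = "(nat \<Rightarrow>\<^sub>0 nat) \<Rightarrow>\<^sub>0 complex"

definition Const :: "complex \<Rightarrow> cpoly" where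
  "Const c = Poly_Mapping.single 0 c"

definition Var :: "nat \<Rightarrow> cpoly" where
  "Var i = Poly_Mapping.single (Poly_Mapping.single i 1) 1"

definition poly_ring :: "nat \<Rightarrow> cpoly set" where
  "poly_ring n = {f. \<forall>m \<in> Poly_Mapping.keys f. Poly_Mapping.keys m \<subseteq> {..<n}}"

(* The subtraction on exponents truncates, but only in terms whose coefficient is 0. *)
definition partial_deriv :: "nat \<Rightarrow> cpoly \<Rightarrow> cpoly" where
  "partial_deriv i f =
     (\<Sum>m \<in> Poly_Mapping.keys f.
        Poly_Mapping.single (m - Poly_Mapping.single i 1)
          (of_nat (Poly_Mapping.lookup m i) * Poly_Mapping.lookup f m))"

(* (i + n - 1) mod n and (i + 1) mod n realise x_{-1} = x_{n-1} and x_n = x_0. *)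
definition D_op :: "nat \<Rightarrow> cpoly \<Rightarrow> cpoly" where
  "D_op n f = (\<Sum>i<n. Var ((i + n - 1) mod n) * partial_deriv i f)"

definition Delta_op :: "nat \<Rightarrow> cpoly \<Rightarrow> cpoly" where
  "Delta_op n f = (\<Sum>i<n. Var ((i + 1) mod n) * partial_deriv i f)"

definition ker_D :: "nat \<Rightarrow> cpoly set" where
  "ker_D n = {f \<in> poly_ring n. D_op n f = 0}"

definition ker_Delta :: "nat \<Rightarrow> cpoly set" where
  "ker_Delta n = {f \<in> poly_ring n. Delta_op n f = 0}"

(* Adding m before subtracting s < m keeps the natural-number difference from truncating. *)
definition circulant_det :: "nat \<Rightarrow> (nat \<Rightarrow> 'a) \<Rightarrow> 'a :: comm_ring_1" where
  "circulant_det m u = det (mat m m (\<lambda>(r, s). u ((r + m - s) mod m)))"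

definition primitive_root_of_unity :: "nat \<Rightarrow> complex \<Rightarrow> bool" where
  "primitive_root_of_unity n z \<longleftrightarrow> z ^ n = 1 \<and> (\<forall>k. 0 < k \<and> k < n \<longrightarrow> z ^ k \<noteq> 1)"

(* The arguments of y_form n z p i j are the order n, the chosen root z of unity, the divisor p of n
   (the superscript), and the two subscripts. *)
definition y_form :: "nat \<Rightarrow> complex \<Rightarrow> nat \<Rightarrow> nat \<Rightarrow> nat \<Rightarrow> cpoly" where
  "y_form n z p i j = (\<Sum>l<n div p. Const (z ^ (i * (j + p * l))) * Var (j + p * l))"

definition is_subalgebra :: "cpoly set \<Rightarrow> bool" where
  "is_subalgebra A \<longleftrightarrow>
     range Const \<subseteq> A \<and> (\<forall>f\<in>A. \<forall>g\<in>A. f + g \<in> A) \<and> (\<forall>f\<in>A. \<forall>g\<in>A. f * g \<in> A)"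

definition generated_subalgebra :: "cpoly set \<Rightarrow> cpoly set" where
  "generated_subalgebra S = is_subalgebra hull S"

end

theory Submission
  imports Defs
begin

text \<open>
  Both operators act on linear forms by a cyclic shift of the variables, so the discrete Fourier
  transform diagonalises them simultaneously: with \<open>Z\<^sub>k = (\<Sum>j<n. z ^ (k * j) x\<^sub>j)\<close> one has
  \<open>D Z\<^sub>k = z ^ k Z\<^sub>k\<close> and \<open>\<Delta> Z\<^sub>k = cnj (z ^ k) Z\<^sub>k\<close>. Both are derivations, hence a product of forms
  \<open>Z\<^sub>k\<close> is an eigenvector of \<open>D\<close>, whose eigenvalue is the sum of the \<open>z ^ k\<close>, and of \<open>\<Delta>\<close>, whose
  eigenvalue is the complex conjugate of that sum.

  \<^emph>\<open>The kernels agree.\<close> Every polynomial \<open>f\<close> in the \<open>n\<close> variables is a linear combination of such products.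
  A univariate polynomial \<open>P\<close> that interpolates complex conjugation on the finitely many
  eigenvalues involved and on \<open>0\<close> gives \<open>\<Delta> f = P(D) f\<close>. Since \<open>P(0) = 0\<close>, \<open>D f = 0\<close> implies
  \<open>\<Delta> f = 0\<close>, and the situation is symmetric in the two operators (\<open>kernel_subset_on_span\<close>).

  \<^emph>\<open>The generators lie in the kernel.\<close> The circulant determinant is the product of its eigenvalues
  (\<open>circulant_det_eq_prod\<close>), and for the given forms these eigenvalues are the \<open>Z\<^sub>k\<close> whose index runs
  through a coset of the subgroup of order \<open>p\<close> in the integers modulo \<open>n\<close>
  (\<open>circulant_y_form_eq_prod\<close>). So each generator corresponds to a rotated regular \<open>p\<close>-gon of roots
  of unity, and the sum of its vertices vanishes.

  \<^emph>\<open>The inclusion is strict.\<close> Products of the \<open>Z\<^sub>k\<close> in the kernel correspond to vanishing sums of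
  \<open>n\<close>-th roots of unity with nonnegative coefficients. For three distinct primes \<open>p\<close>, \<open>q\<close>, \<open>r\<close>
  dividing \<open>n\<close>, let \<open>A\<^sub>p\<close> be the sum of the \<open>p\<close>-th roots of unity other than \<open>1\<close>; then
  \<open>A\<^sub>p A\<^sub>q + A\<^sub>r = (- 1) (- 1) + (- 1) = 0\<close> is a vanishing sum that contains the root with index
  \<open>n / r\<close>, but no regular polygon of prime order through that root (\<open>coset_leaves_two_type_index\<close>).
  Two points of affine space then separate the corresponding product from the subalgebra. At the
  first point the \<open>Z\<^sub>k\<close> are \<open>1\<close> for the roots of a set containing the vanishing sum and \<open>0\<close>
  elsewhere; at the second, the coordinate with index \<open>n / r\<close> is changed to \<open>0\<close> as well. Every
  generator takes the same value at both points, the product does not (\<open>witness_not_generated\<close>).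
\<close>

section \<open>Polynomials as finite sums of terms\<close>

lemma cpoly_induct [case_names single add]:
  fixes f :: cpoly
  assumes single: "\<And>m c. P (Poly_Mapping.single m c)"
    and add: "\<And>f g. P f \<Longrightarrow> P g \<Longrightarrow> P (f + g)"
  shows "P f"
proof (induction f rule: Poly_Mapping.update_induct)
  case const
  show ?case using single[of 0 0] by simp
next
  case (update f a b)
  have "Poly_Mapping.update a b f = f + Poly_Mapping.single a b"
    using update(1)
    by (intro poly_mapping_eqI) (auto simp: lookup_add lookup_single lookup_update in_keys_iff when_def)
  with update(3) single[of a b] add show ?case by simp
qed

lemma Const_0 [simp]: "Const 0 = 0"
  and Const_1 [simp]: "Const 1 = 1"
  by (simp_all add: Const_def)

lemma Const_add: "Const (a + b) = Const a + Const b"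
  by (simp add: Const_def single_add)

lemma Const_mult: "Const (a * b) = Const a * Const b"
  by (simp add: Const_def mult_single)

lemma Const_sum: "Const (sum h A) = (\<Sum>i\<in>A. Const (h i))"
  by (induction A rule: infinite_finite_induct) (auto simp: Const_add)

lemma Const_of_nat: "Const (of_nat k) = of_nat k"
  by (simp add: Const_def)

lemma poly_ring_add: "f \<in> poly_ring n \<Longrightarrow> g \<in> poly_ring n \<Longrightarrow> f + g \<in> poly_ring n"
  using Poly_Mapping.keys_add[of f g] unfolding poly_ring_def by blast

lemma poly_ring_mult:
  assumes "f \<in> poly_ring n" "g \<in> poly_ring n"
  shows "f * g \<in> poly_ring n"
proof -
  have "Poly_Mapping.keys m \<subseteq> {..<n}" if m: "m \<in> Poly_Mapping.keys (f * g)" for m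
  proof -
    from m Poly_Mapping.keys_mult[of f g] obtain a b where
      "a \<in> Poly_Mapping.keys f" "b \<in> Poly_Mapping.keys g" "m = a + b" by blast
    with assms Poly_Mapping.keys_add[of a b] show ?thesis
      unfolding poly_ring_def by blast
  qed
  then show ?thesis by (simp add: poly_ring_def)
qed

lemma Const_in_poly_ring: "Const c \<in> poly_ring n"
  by (simp add: poly_ring_def Const_def)

lemma Var_in_poly_ring: "j < n \<Longrightarrow> Var j \<in> poly_ring n"
  by (simp add: poly_ring_def Var_def)

lemma poly_ring_sum: "(\<And>i. i \<in> A \<Longrightarrow> h i \<in> poly_ring n) \<Longrightarrow> sum h A \<in> poly_ring n"
  by (induction A rule: infinite_finite_induct)
     (use Const_in_poly_ring[of 0 n] in \<open>auto intro: poly_ring_add\<close>)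

lemma poly_ring_prod: "(\<And>i. i \<in> A \<Longrightarrow> h i \<in> poly_ring n) \<Longrightarrow> prod h A \<in> poly_ring n"
  by (induction A rule: infinite_finite_induct)
     (use Const_in_poly_ring[of 1 n] in \<open>auto intro: poly_ring_mult\<close>)

lemma Var_power: "Var a ^ b = Poly_Mapping.single (Poly_Mapping.single a b) 1"
  by (induction b) (simp_all add: Var_def mult_single single_add[symmetric] del: single_of_nat)

lemma poly_ring_subset_subalgebra:
  assumes B: "is_subalgebra B" and V: "\<And>j. j < n \<Longrightarrow> Var j \<in> B"
  shows "poly_ring n \<subseteq> B"
proof
  fix f assume f: "f \<in> poly_ring n"
  have C: "Const c \<in> B" for c using B by (auto simp: is_subalgebra_def)
  have add: "g \<in> B \<Longrightarrow> h \<in> B \<Longrightarrow> g + h \<in> B" 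
    and mult: "g \<in> B \<Longrightarrow> h \<in> B \<Longrightarrow> g * h \<in> B" for g h
    using B by (auto simp: is_subalgebra_def)
  have pow: "g ^ k \<in> B" if "g \<in> B" for g k
    by (induction k) (use C[of 1] mult that in auto)
  have mono: "Poly_Mapping.keys m \<subseteq> {..<n} \<Longrightarrow> Poly_Mapping.single m 1 \<in> B" for m
  proof (induction m rule: Poly_Mapping.update_induct)
    case const
    show ?case using C[of 1] by simp
  next
    case (update m a b)
    have eq: "Poly_Mapping.update a b m = m + Poly_Mapping.single a b"
      using update(1)
      by (intro poly_mapping_eqI) (auto simp: lookup_add lookup_single lookup_update in_keys_iff when_def)
    have "Poly_Mapping.keys (Poly_Mapping.update a b m) = insert a (Poly_Mapping.keys m)"
      using update(2) by (auto simp: keys_update)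
    with update have "Poly_Mapping.single m 1 \<in> B" "a < n" by auto
    then have "Poly_Mapping.single m 1 * Var a ^ b \<in> B" using V mult pow by blast
    then show ?case by (simp add: eq Var_power mult_single)
  qed
  from f show "f \<in> B"
  proof (induction f rule: Poly_Mapping.update_induct)
    case const
    show ?case using C[of 0] by simp
  next
    case (update f m c)
    have eq: "Poly_Mapping.update m c f = f + Const c * Poly_Mapping.single m 1"
      using update(1)
      by (intro poly_mapping_eqI) 
         (auto simp: Const_def mult_single lookup_add lookup_single lookup_update in_keys_iff when_def)
    have "Poly_Mapping.keys (Poly_Mapping.update m c f) = insert m (Poly_Mapping.keys f)"
      using update(2) by (auto simp: keys_update)
    with update have "f \<in> B" "Poly_Mapping.keys m \<subseteq> {..<n}" by (auto simp: poly_ring_def)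
    then show ?case unfolding eq using mono C add mult by blast
  qed
qed

section \<open>Evaluation at a point\<close>

definition monom_eval :: "(nat \<Rightarrow> complex) \<Rightarrow> (nat \<Rightarrow>\<^sub>0 nat) \<Rightarrow> complex" where
  "monom_eval x m = (\<Prod>i\<in>Poly_Mapping.keys m. x i ^ Poly_Mapping.lookup m i)"

definition poly_eval :: "(nat \<Rightarrow> complex) \<Rightarrow> cpoly \<Rightarrow> complex" where
  "poly_eval x f = (\<Sum>m\<in>Poly_Mapping.keys f. Poly_Mapping.lookup f m * monom_eval x m)"

lemma monom_eval_add: "monom_eval x (m + m') = monom_eval x m * monom_eval x m'"
proof -
  let ?K = "Poly_Mapping.keys m \<union> Poly_Mapping.keys m'"
  have eq: "monom_eval x l = (\<Prod>i\<in>?K. x i ^ Poly_Mapping.lookup l i)"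
    if "Poly_Mapping.keys l \<subseteq> ?K" for l
    unfolding monom_eval_def using that
    by (intro prod.mono_neutral_left) (auto simp: in_keys_iff)
  show ?thesis
    using Poly_Mapping.keys_add[of m m']
    by (simp add: eq lookup_add power_add prod.distrib)
qed

lemma poly_eval_single [simp]: "poly_eval x (Poly_Mapping.single m c) = c * monom_eval x m"
  by (simp add: poly_eval_def)

lemma poly_eval_add: "poly_eval x (f + g) = poly_eval x f + poly_eval x g"
  unfolding poly_eval_def by (rule setsum_keys_plus_distrib) (simp_all add: algebra_simps)

lemma poly_eval_mult: "poly_eval x (f * g) = poly_eval x f * poly_eval x g"
proof (induction f rule: cpoly_induct)
  case (single m c)
  show ?case
    by (induction g rule: cpoly_induct)
       (simp_all add: mult_single monom_eval_add poly_eval_add algebra_simps)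
qed (simp add: poly_eval_add algebra_simps)

lemma poly_eval_Const [simp]: "poly_eval x (Const c) = c"
  by (simp add: Const_def monom_eval_def)

lemma poly_eval_Var [simp]: "poly_eval x (Var j) = x j"
  by (simp add: Var_def monom_eval_def)

lemma poly_eval_sum: "poly_eval x (sum h A) = (\<Sum>i\<in>A. poly_eval x (h i))"
  by (induction A rule: infinite_finite_induct)
     (use poly_eval_Const[of x 0] in \<open>auto simp: poly_eval_add\<close>)

lemma poly_eval_prod: "poly_eval x (prod h A) = (\<Prod>i\<in>A. poly_eval x (h i))"
  by (induction A rule: infinite_finite_induct)
     (use poly_eval_Const[of x 1] in \<open>auto simp: poly_eval_mult\<close>)

section \<open>Derivations\<close>

definition derivation :: "(cpoly \<Rightarrow> cpoly) \<Rightarrow> bool" where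
  "derivation A \<longleftrightarrow> (\<forall>f g. A (f + g) = A f + A g) \<and> (\<forall>f g. A (f * g) = f * A g + A f * g)
     \<and> (\<forall>c. A (Const c) = 0)"

lemma derivation_add: "derivation A \<Longrightarrow> A (f + g) = A f + A g"
  and derivation_mult: "derivation A \<Longrightarrow> A (f * g) = f * A g + A f * g"
  and derivation_Const: "derivation A \<Longrightarrow> A (Const c) = 0"
  by (simp_all add: derivation_def)

lemma derivation_0: "derivation A \<Longrightarrow> A 0 = 0"
  using derivation_Const[of A 0] by simp

lemma derivation_scale: "derivation A \<Longrightarrow> A (Const c * f) = Const c * A f"
  by (simp add: derivation_mult derivation_Const)

lemma derivation_sum: "derivation A \<Longrightarrow> A (sum h I) = (\<Sum>i\<in>I. A (h i))"
  by (induction I rule: infinite_finite_induct) (simp_all add: derivation_add derivation_0)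

lemma partial_deriv_single:
  "partial_deriv i (Poly_Mapping.single m c) =
     Poly_Mapping.single (m - Poly_Mapping.single i 1) (of_nat (Poly_Mapping.lookup m i) * c)"
  by (simp add: partial_deriv_def)

lemma partial_deriv_add: "partial_deriv i (f + g) = partial_deriv i f + partial_deriv i g"
  unfolding partial_deriv_def
  by (rule setsum_keys_plus_distrib) (simp_all add: single_add[symmetric] algebra_simps)

text \<open>
  The exponents agree although subtraction truncates: it can truncate only where the variable is
  absent, and there the coefficient produced by differentiation is \<open>0\<close>.
\<close>

lemma partial_deriv_mult_single:
  "partial_deriv i (Poly_Mapping.single m a * Poly_Mapping.single m' b) =
     Poly_Mapping.single m a * partial_deriv i (Poly_Mapping.single m' b)
     + partial_deriv i (Poly_Mapping.single m a) * Poly_Mapping.single m' b"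
proof -
  let ?e = "Poly_Mapping.single i (1::nat)"
  have shift: "l + (l' - ?e) = l + l' - ?e" if "Poly_Mapping.lookup l' i > 0" for l l'
    using that by (intro poly_mapping_eqI) (auto simp: lookup_add lookup_minus lookup_single when_def)
  have right: "Poly_Mapping.single (m + (m' - ?e)) (of_nat (Poly_Mapping.lookup m' i) * (a * b)) =
        Poly_Mapping.single (m + m' - ?e) (of_nat (Poly_Mapping.lookup m' i) * (a * b))"
    by (cases "Poly_Mapping.lookup m' i = 0") (simp_all add: shift del: One_nat_def)
  have left: "Poly_Mapping.single (m - ?e + m') (of_nat (Poly_Mapping.lookup m i) * (a * b)) =
        Poly_Mapping.single (m + m' - ?e) (of_nat (Poly_Mapping.lookup m i) * (a * b))"
    by (cases "Poly_Mapping.lookup m i = 0") 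
       (use shift[of m m'] in \<open>simp_all add: shift add.commute del: One_nat_def\<close>)
  show ?thesis
    using right left
    by (simp add: partial_deriv_single mult_single lookup_add algebra_simps single_add[symmetric])
qed

lemma partial_deriv_mult:
  "partial_deriv i (f * g) = f * partial_deriv i g + partial_deriv i f * g"
proof (induction f rule: cpoly_induct)
  case (single m c)
  show ?case
    by (induction g rule: cpoly_induct)
       (simp_all add: partial_deriv_mult_single partial_deriv_add algebra_simps)
qed (simp add: partial_deriv_add algebra_simps)

lemma partial_deriv_Const: "partial_deriv i (Const c) = 0"
  by (simp add: Const_def partial_deriv_single)

lemma partial_deriv_Var: "partial_deriv i (Var j) = (if i = j then 1 else 0)"
  by (simp add: Var_def partial_deriv_single lookup_single when_def)

text \<open>
  A vector field is determined by its coefficients \<open>w\<close>; both operators under study are of this form.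
\<close>

lemma derivation_vector_field: "derivation (\<lambda>f. \<Sum>i<n. w i * partial_deriv i f)"
  by (simp add: derivation_def partial_deriv_add partial_deriv_mult partial_deriv_Const
        algebra_simps sum.distrib sum_distrib_left)

lemma derivation_D_op: "derivation (D_op n)"
  using derivation_vector_field[of "\<lambda>i. Var ((i + n - 1) mod n)" n]
  by (simp add: D_op_def[abs_def])

lemma derivation_Delta_op: "derivation (Delta_op n)"
  using derivation_vector_field[of "\<lambda>i. Var ((i + 1) mod n)" n]
  by (simp add: Delta_op_def[abs_def])

lemma D_op_Var: "j < n \<Longrightarrow> D_op n (Var j) = Var ((j + n - 1) mod n)"
  by (simp add: D_op_def partial_deriv_Var if_distrib[of "(*) _"] cong: if_cong)

lemma Delta_op_Var: "j < n \<Longrightarrow> Delta_op n (Var j) = Var ((j + 1) mod n)"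
  by (simp add: Delta_op_def partial_deriv_Var if_distrib[of "(*) _"] cong: if_cong)

lemma is_subalgebra_ker_D: "is_subalgebra (ker_D n)"
  unfolding is_subalgebra_def ker_D_def
  using derivation_D_op[of n]
  by (auto simp: poly_ring_add poly_ring_mult Const_in_poly_ring
        derivation_add derivation_mult derivation_Const)

lemma eigenvector_mult:
  assumes "derivation A" "A v = Const a * v" "A w = Const b * w"
  shows "A (v * w) = Const (a + b) * (v * w)"
  using assms by (simp add: derivation_mult Const_add algebra_simps)

lemma eigenvector_prod:
  assumes "derivation A" "\<And>i. i \<in> I \<Longrightarrow> A (v i) = Const (a i) * v i"
  shows "A (prod v I) = Const (sum a I) * prod v I"
  using assms(2)
proof (induction I rule: infinite_finite_induct)
  case (insert i I)
  then have "A (v i * prod v I) = Const (a i + sum a I) * (v i * prod v I)"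
    by (intro eigenvector_mult assms(1)) auto
  with insert show ?case by simp
qed (use derivation_Const[OF assms(1), of 1] in auto)

section \<open>Operators with conjugate eigenvalues have the same kernel\<close>

text \<open>
  The relation between the two operators that equates their kernels is isolated here: on each
  simultaneous eigenvector the eigenvalues are complex conjugate. It is symmetric in the operators.
\<close>

definition conj_eigenvector :: "(cpoly \<Rightarrow> cpoly) \<Rightarrow> (cpoly \<Rightarrow> cpoly) \<Rightarrow> cpoly \<Rightarrow> bool" where
  "conj_eigenvector A B v \<longleftrightarrow> (\<exists>a. A v = Const a * v \<and> B v = Const (cnj a) * v)"

text \<open>
  Scalar multiples of eigenvectors are eigenvectors, so finite sums suffice for the linear span.
  Generating the sums one summand at a time avoids grouping them by eigenvalue.
\<close>

inductive_set conj_eigen_span :: "(cpoly \<Rightarrow> cpoly) \<Rightarrow> (cpoly \<Rightarrow> cpoly) \<Rightarrow> cpoly set" for A B where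
  zero: "0 \<in> conj_eigen_span A B"
| add: "conj_eigenvector A B v \<Longrightarrow> f \<in> conj_eigen_span A B \<Longrightarrow> v + f \<in> conj_eigen_span A B"

lemma conj_eigenvector_sym: "conj_eigenvector A B v \<Longrightarrow> conj_eigenvector B A v"
  unfolding conj_eigenvector_def by (metis complex_cnj_cnj)

lemma conj_eigen_span_sym: "f \<in> conj_eigen_span A B \<Longrightarrow> f \<in> conj_eigen_span B A"
  by (induction rule: conj_eigen_span.induct)
     (auto intro: conj_eigen_span.intros conj_eigenvector_sym)

lemma conj_eigen_span_single: "conj_eigenvector A B v \<Longrightarrow> v \<in> conj_eigen_span A B"
  using conj_eigen_span.add[OF _ conj_eigen_span.zero] by fastforce

lemma conj_eigen_span_add:
  "f \<in> conj_eigen_span A B \<Longrightarrow> g \<in> conj_eigen_span A B \<Longrightarrow> f + g \<in> conj_eigen_span A B"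
  by (induction rule: conj_eigen_span.induct) (auto simp: add.assoc intro: conj_eigen_span.intros)

lemma conj_eigenvector_mult:
  assumes "derivation A" "derivation B" "conj_eigenvector A B v" "conj_eigenvector A B w"
  shows "conj_eigenvector A B (v * w)"
proof -
  from assms(3,4) obtain a b where
    "A v = Const a * v" "B v = Const (cnj a) * v" "A w = Const b * w" "B w = Const (cnj b) * w"
    unfolding conj_eigenvector_def by blast
  with eigenvector_mult[OF assms(1)] eigenvector_mult[OF assms(2)] show ?thesis
    unfolding conj_eigenvector_def by (metis complex_cnj_add)
qed

text \<open>
  For derivations, eigenvalues add when eigenvectors are multiplied, and conjugation is additive.
  Hence products of sums of eigenvectors are again sums of eigenvectors, which is why the variables
  alone decide whether a whole polynomial ring lies in the span.
\<close>

lemma conj_eigen_span_mult: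
  assumes "derivation A" "derivation B" "f \<in> conj_eigen_span A B" "g \<in> conj_eigen_span A B"
  shows "f * g \<in> conj_eigen_span A B"
proof -
  have one: "v * g \<in> conj_eigen_span A B" if v: "conj_eigenvector A B v" for v
    using assms(4)
    by (induction rule: conj_eigen_span.induct)
       (auto simp: distrib_left intro: conj_eigen_span.intros conj_eigenvector_mult assms(1,2) v)
  from assms(3) show ?thesis
    by (induction rule: conj_eigen_span.induct)
       (auto simp: distrib_right intro: conj_eigen_span.zero conj_eigen_span_add one)
qed

lemma is_subalgebra_conj_eigen_span:
  assumes "derivation A" "derivation B"
  shows "is_subalgebra (conj_eigen_span A B)"
proof -
  have "conj_eigenvector A B (Const c)" for c
    unfolding conj_eigenvector_def
    by (rule exI[of _ 0]) (simp add: derivation_Const assms)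
  then show ?thesis
    unfolding is_subalgebra_def
    by (auto intro: conj_eigen_span_single conj_eigen_span_add conj_eigen_span_mult assms)
qed

lemma interpolating_poly:
  fixes g :: "'a :: field \<Rightarrow> 'a"
  assumes "finite L"
  shows "\<exists>P. \<forall>a\<in>L. poly P a = g a"
  using assms
proof (induction L)
  case (insert b L)
  then obtain P where P: "\<And>a. a \<in> L \<Longrightarrow> poly P a = g a" by blast
  define R where "R = (\<Prod>a\<in>L. [:- a, 1:])"
  have R0: "poly R a = 0" if "a \<in> L" for a
    using that insert(1) by (auto simp: R_def poly_prod prod_zero_iff)
  have Rb: "poly R b \<noteq> 0"
    using insert(1,2) by (auto simp: R_def poly_prod prod_zero_iff)
  have "\<forall>a\<in>insert b L. poly (P + smult ((g b - poly P b) / poly R b) R) a = g a"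
    using P R0 Rb by auto
  then show ?case by blast
qed auto

definition apply_poly :: "complex poly \<Rightarrow> (cpoly \<Rightarrow> cpoly) \<Rightarrow> cpoly \<Rightarrow> cpoly" where
  "apply_poly P A f = (\<Sum>i\<le>degree P. Const (coeff P i) * (A ^^ i) f)"

lemma apply_poly_add:
  assumes "derivation A"
  shows "apply_poly P A (f + g) = apply_poly P A f + apply_poly P A g"
proof -
  have "(A ^^ i) (f + g) = (A ^^ i) f + (A ^^ i) g" for i
    by (induction i) (simp_all add: derivation_add assms)
  then show ?thesis by (simp add: apply_poly_def distrib_left sum.distrib)
qed

lemma apply_poly_eigenvector:
  assumes "derivation A" "A v = Const a * v"
  shows "apply_poly P A v = Const (poly P a) * v"
proof -
  have "(A ^^ i) v = Const (a ^ i) * v" for i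
  proof (induction i)
    case (Suc i)
    then show ?case by (simp add: derivation_scale[OF assms(1)] assms(2) Const_mult mult.left_commute mult.assoc)
  qed simp
  then show ?thesis
    by (simp add: apply_poly_def poly_altdef Const_sum Const_mult sum_distrib_right mult.assoc)
qed

text \<open>
  The operator \<open>P(A)\<close> multiplies an eigenvector with eigenvalue \<open>a\<close> by \<open>P(a)\<close>, while \<open>B\<close> multiplies
  it by \<open>cnj a\<close>. The set \<open>L\<close> collects the eigenvalues of the summands of \<open>f\<close>.
\<close>

lemma apply_poly_eq_on_span:
  assumes A: "derivation A" and B: "derivation B" and f: "f \<in> conj_eigen_span A B"
  shows "\<exists>L. finite L \<and> (\<forall>P. (\<forall>a\<in>L. poly P a = cnj a) \<longrightarrow> apply_poly P A f = B f)"
  using f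
proof (induction rule: conj_eigen_span.induct)
  case zero
  have "apply_poly P A 0 = 0" for P
    using apply_poly_eigenvector[OF A, of 0 0 P] by (simp add: derivation_0 A)
  then show ?case by (intro exI[of _ "{}"]) (simp add: derivation_0 B)
next
  case (add v f)
  then obtain L where L: "finite L"
    "\<And>P. \<forall>a\<in>L. poly P a = cnj a \<Longrightarrow> apply_poly P A f = B f" by blast
  from add(1) obtain a where a: "A v = Const a * v" "B v = Const (cnj a) * v"
    unfolding conj_eigenvector_def by blast
  show ?case
    by (rule exI[of _ "insert a L"])
       (simp add: L apply_poly_add[OF A] apply_poly_eigenvector[OF A a(1)] a(2) derivation_add[OF B])
qed

text \<open>
  Conjugation fixes \<open>0\<close>, so the interpolating polynomial can be taken with zero constant
  coefficient; all its other terms contain a power of \<open>A\<close> that annihilates \<open>f\<close>.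
\<close>

lemma kernel_subset_on_span:
  assumes A: "derivation A" and B: "derivation B" and f: "f \<in> conj_eigen_span A B"
    and "A f = 0"
  shows "B f = 0"
proof -
  obtain L where L: "finite L" "\<And>P. \<forall>a\<in>L. poly P a = cnj a \<Longrightarrow> apply_poly P A f = B f"
    using apply_poly_eq_on_span[OF A B f] by blast
  obtain P where P: "\<forall>a\<in>insert 0 L. poly P a = cnj a"
    using interpolating_poly[of "insert 0 L" cnj] L(1) by auto
  have "(A ^^ i) f = 0" if "i > 0" for i
    using that
  proof (induction i rule: nat_induct_non_zero)
    case 1
    show ?case using assms(4) by simp
  qed (simp add: derivation_0 A)
  moreover have "coeff P 0 = 0" using P by (simp add: poly_0_coeff_0)
  ultimately have "Const (coeff P i) * (A ^^ i) f = 0" for i by (cases "i = 0") auto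
  then have "apply_poly P A f = 0" unfolding apply_poly_def by (intro sum.neutral) simp
  with L(2)[of P] P show ?thesis by simp
qed

section \<open>Roots of unity\<close>

lemma root_power_eq_1_iff:
  assumes "primitive_root_of_unity n z" "n > 0"
  shows "z ^ k = 1 \<longleftrightarrow> n dvd k"
proof -
  have "z ^ k = z ^ (n * (k div n) + k mod n)" by simp
  also have "\<dots> = z ^ (k mod n)"
    using assms(1) by (simp only: power_add power_mult) (simp add: primitive_root_of_unity_def)
  finally have "z ^ k = 1 \<longleftrightarrow> z ^ (k mod n) = 1" by simp
  also have "\<dots> \<longleftrightarrow> k mod n = 0"
    using assms mod_less_divisor[of n k] unfolding primitive_root_of_unity_def
    by (metis gr0I power_0)
  finally show ?thesis by (simp add: mod_eq_0_iff_dvd)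
qed

lemma root_power_mod:
  assumes "primitive_root_of_unity n z"
  shows "z ^ (k mod n * j) = z ^ (k * j)"
proof -
  have "z ^ (k * j) = z ^ (n * (k div n * j) + k mod n * j)"
    by (metis add_mult_distrib mult.assoc mult_div_mod_eq)
  also have "\<dots> = z ^ (k mod n * j)"
    using assms by (simp only: power_add power_mult) (simp add: primitive_root_of_unity_def)
  finally show ?thesis by simp
qed

lemma root_mult_cnj:
  assumes "primitive_root_of_unity n z" "n > 0"
  shows "z ^ k * cnj z ^ k = 1"
proof -
  have "norm z ^ n = 1" using assms(1) by (simp add: primitive_root_of_unity_def flip: norm_power)
  then have "norm z = 1" using assms(2) power_eq_1_iff by fastforce
  then have "z * cnj z = 1" using complex_norm_square[of z] by simp
  then show ?thesis by (simp flip: power_mult_distrib)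
qed

lemma sum_root_powers:
  assumes "primitive_root_of_unity n z" "n > 0" "\<not> n dvd d"
  shows "(\<Sum>k<n. z ^ (d * k)) = 0"
proof -
  have "z ^ d \<noteq> 1" using assms root_power_eq_1_iff by blast
  moreover have "(z ^ d) ^ n = 1" using assms root_power_eq_1_iff by (simp flip: power_mult)
  ultimately show ?thesis by (simp add: power_mult geometric_sum)
qed

text \<open>
  This is the orthogonality of the characters of the cyclic group of order \<open>n\<close>. It inverts the
  Fourier matrix, whether the entries are read as numbers or as constant polynomials.
\<close>

lemma root_orthogonality:
  assumes z: "primitive_root_of_unity n z" and i: "i < n" and j: "j < n"
  shows "(\<Sum>k<n. z ^ (k * i) * cnj z ^ (k * j)) = (if i = j then of_nat n else 0)"
proof (cases "i = j")
  case True
  then show ?thesis using root_mult_cnj[OF z] i by simp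
next
  case False
  have n: "n > 0" using i by simp
  \<comment> \<open>The inverse of \<open>z ^ j\<close> is \<open>z ^ (n - j)\<close>; this turns the sum into a geometric one.\<close>
  have "z ^ (k * i) * cnj z ^ (k * j) = z ^ ((i + (n - j)) * k)" for k
  proof -
    have "z ^ ((i + (n - j)) * k) = z ^ (k * i) * z ^ (k * (n - j)) * (z ^ (k * j) * cnj z ^ (k * j))"
      by (simp add: root_mult_cnj[OF z n] algebra_simps flip: power_add)
    also have "\<dots> = z ^ (k * i) * cnj z ^ (k * j) * z ^ (k * (n - j) + k * j)"
      by (simp add: power_add)
    also have "k * (n - j) + k * j = k * n" using j by (simp flip: add_mult_distrib2)
    also have "z ^ (k * n) = 1" using root_power_eq_1_iff[OF z n] by simp
    finally show ?thesis by simp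
  qed
  moreover have "\<not> n dvd i + (n - j)"
  proof
    assume "n dvd i + (n - j)"
    moreover have "0 < i + (n - j)" "i + (n - j) < n + n" using i j by auto
    ultimately have "i + (n - j) = n"
      by (metis dvd_diff_nat dvd_imp_le dvd_refl le_antisym less_diff_conv2 nat_dvd_not_less
          not_less zero_less_diff)
    with j False show False by simp
  qed
  ultimately show ?thesis using sum_root_powers[OF z n] False by simp
qed

lemma primitive_root_power:
  assumes z: "primitive_root_of_unity n z" and n: "n > 0" and p: "p dvd n"
  shows "primitive_root_of_unity p (z ^ (n div p))"
proof -
  from p n obtain m where m: "n = p * m" "p > 0" "m > 0" by (auto elim: dvdE)
  then have nd: "n div p = m" by simp
  have "(z ^ m) ^ k = 1 \<longleftrightarrow> p dvd k" for k
    using root_power_eq_1_iff[OF z n, of "m * k"] m by (simp add: mult.commute flip: power_mult)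
  then show ?thesis unfolding primitive_root_of_unity_def nd using nat_dvd_not_less by auto
qed

lemma mod_shift_cancel:
  fixes b p s :: nat
  assumes "b < p" "s \<le> p"
  shows "((b + s) mod p + p - s) mod p = b" "((b + p - s) mod p + s) mod p = b"
proof -
  have "((b + s) mod p + p - s) mod p = ((b + s) mod p + (p - s)) mod p" using assms by simp
  also have "\<dots> = (b + s + (p - s)) mod p" by (rule mod_add_left_eq)
  finally show "((b + s) mod p + p - s) mod p = b" using assms by simp
  show "((b + p - s) mod p + s) mod p = b" using assms by (simp add: mod_add_left_eq)
qed

section \<open>Factorisation of the circulant determinant\<close>

text \<open>
  The rows of the Fourier matrix \<open>G\<close> are left eigenvectors of the circulant matrix \<open>M\<close>, that is
  \<open>G M = E G\<close> with the diagonal matrix \<open>E\<close> of eigenvalues \<open>\<mu> m\<close>. The matrix \<open>H\<close> of conjugate entries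
  satisfies \<open>G H = p 1\<close>, so \<open>det G\<close> is nonzero and cancels in the integral domain of polynomials.
\<close>

lemma circulant_det_eq_prod:
  assumes \<omega>: "primitive_root_of_unity p \<omega>" and p: "p > 0"
  shows "circulant_det p u = (\<Prod>m<p. \<Sum>t<p. Const (\<omega> ^ (m * t)) * u t)"
proof -
  define \<mu> where "\<mu> m = (\<Sum>t<p. Const (\<omega> ^ (m * t)) * u t)" for m
  define M where "M = mat p p (\<lambda>(r, s). u ((r + p - s) mod p))"
  define G where "G = mat p p (\<lambda>(m, r). Const (\<omega> ^ (m * r)))"
  define H where "H = mat p p (\<lambda>(r, s). Const (cnj \<omega> ^ (r * s)))"
  define E where "E = mat p p (\<lambda>(r, s). if r = s then \<mu> r else 0)"
  have carrier: "M \<in> carrier_mat p p" "G \<in> carrier_mat p p" "H \<in> carrier_mat p p" "E \<in> carrier_mat p p"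
    by (simp_all add: M_def G_def H_def E_def)
  have shift: "(\<Sum>r<p. Const (\<omega> ^ (m * r)) * u ((r + p - s) mod p)) = \<mu> m * Const (\<omega> ^ (m * s))"
    if "s < p" for m s
  proof -
    have "(\<Sum>r<p. Const (\<omega> ^ (m * r)) * u ((r + p - s) mod p)) =
        (\<Sum>t<p. Const (\<omega> ^ (m * ((t + s) mod p))) * u t)"
      using that p
      by (intro sum.reindex_bij_witness[of _ "\<lambda>t. (t + s) mod p" "\<lambda>r. (r + p - s) mod p"])
         (auto simp: mod_shift_cancel)
    also have "\<dots> = (\<Sum>t<p. Const (\<omega> ^ (m * t) * \<omega> ^ (m * s)) * u t)"
    proof -
      have "\<omega> ^ (m * ((t + s) mod p)) = \<omega> ^ (m * t) * \<omega> ^ (m * s)" for t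
        using root_power_mod[OF \<omega>, of "t + s" m] by (simp add: algebra_simps power_add)
      then show ?thesis by simp
    qed
    finally show ?thesis by (simp add: \<mu>_def Const_mult sum_distrib_left mult_ac)
  qed
  have "G * M = E * G"
  proof (intro eq_matI)
    fix m s assume "m < dim_row (E * G)" "s < dim_col (E * G)"
    then have ms: "m < p" "s < p" by (simp_all add: E_def G_def)
    have "(G * M) $$ (m, s) = \<mu> m * Const (\<omega> ^ (m * s))"
      using ms shift[of s m] by (simp add: G_def M_def scalar_prod_def lessThan_atLeast0)
    moreover have "(E * G) $$ (m, s) = \<mu> m * Const (\<omega> ^ (m * s))"
      using ms by (simp add: G_def E_def scalar_prod_def if_distrib[of "\<lambda>x. x * _"] cong: if_cong)
    ultimately show "(G * M) $$ (m, s) = (E * G) $$ (m, s)" by simp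
  qed (simp_all add: G_def M_def E_def)
  then have "det G * det M = det E * det G"
    using carrier det_mult by metis
  moreover have "det G \<noteq> 0"
  proof
    assume 0: "det G = 0"
    have "G * H = of_nat p \<cdot>\<^sub>m 1\<^sub>m p"
    proof (intro eq_matI)
      fix r s assume "r < dim_row (of_nat p \<cdot>\<^sub>m 1\<^sub>m p :: cpoly mat)" "s < dim_col (of_nat p \<cdot>\<^sub>m 1\<^sub>m p :: cpoly mat)"
      then have rs: "r < p" "s < p" by simp_all
      have "(G * H) $$ (r, s) = Const (\<Sum>k<p. \<omega> ^ (k * r) * cnj \<omega> ^ (k * s))"
        using rs by (simp add: G_def H_def scalar_prod_def lessThan_atLeast0 Const_sum Const_mult mult_ac)
      then show "(G * H) $$ (r, s) = (of_nat p \<cdot>\<^sub>m 1\<^sub>m p) $$ (r, s)"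
        using rs by (simp add: root_orthogonality[OF \<omega>] Const_of_nat)
    qed (simp_all add: G_def H_def)
    then have "det G * det H = of_nat p ^ p"
      using det_mult[OF carrier(2,3)] by (simp add: det_smult)
    with 0 p show False by simp
  qed
  ultimately have "det M = det E" by simp
  also have "det E = (\<Prod>m<p. \<mu> m)"
  proof -
    have "upper_triangular E" by (auto simp: E_def)
    then have "det E = prod_list (diag_mat E)" using carrier(4) by (rule det_upper_triangular)
    then show ?thesis
      by (simp add: prod_list_diag_prod E_def lessThan_atLeast0)
  qed
  finally show ?thesis by (simp add: circulant_det_def M_def \<mu>_def)
qed

section \<open>The Fourier coordinates\<close>

definition fourier_form :: "nat \<Rightarrow> complex \<Rightarrow> nat \<Rightarrow> cpoly" where
  "fourier_form n z k = (\<Sum>j<n. Const (z ^ (k * j)) * Var j)"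

lemma fourier_form_in_poly_ring: "fourier_form n z k \<in> poly_ring n"
  unfolding fourier_form_def
  by (intro poly_ring_sum poly_ring_mult Const_in_poly_ring Var_in_poly_ring) simp

lemma D_op_fourier_form:
  assumes z: "primitive_root_of_unity n z" and n: "n > 0"
  shows "D_op n (fourier_form n z k) = Const (z ^ k) * fourier_form n z k"
proof -
  have "D_op n (fourier_form n z k) = (\<Sum>j<n. Const (z ^ (k * j)) * Var ((j + n - 1) mod n))"
    using derivation_D_op
    by (simp add: fourier_form_def derivation_sum derivation_scale D_op_Var)
  also have "\<dots> = (\<Sum>j<n. Const (z ^ (k * ((j + 1) mod n))) * Var j)"
    using n
    by (intro sum.reindex_bij_witness[of _ "\<lambda>j. (j + 1) mod n" "\<lambda>j. (j + n - 1) mod n"])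
       (use mod_shift_cancel[of _ n 1] in auto)
  also have "\<dots> = (\<Sum>j<n. Const (z ^ k * z ^ (k * j)) * Var j)"
  proof -
    have "z ^ (k * ((j + 1) mod n)) = z ^ k * z ^ (k * j)" for j
      using root_power_mod[OF z, of "j + 1" k] by (simp add: algebra_simps power_add)
    then show ?thesis by simp
  qed
  finally show ?thesis by (simp add: fourier_form_def Const_mult sum_distrib_left mult.assoc)
qed

text \<open>
  The operator \<open>\<Delta>\<close> shifts in the opposite direction, so its eigenvalue is the inverse of \<open>z ^ k\<close>,
  which is the conjugate because roots of unity lie on the unit circle.
\<close>

lemma Delta_op_fourier_form:
  assumes z: "primitive_root_of_unity n z" and n: "n > 0"
  shows "Delta_op n (fourier_form n z k) = Const (cnj z ^ k) * fourier_form n z k"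
proof -
  have root: "z ^ (k * ((j + n - 1) mod n)) = cnj z ^ k * z ^ (k * j)" for j
  proof -
    have "z ^ (k * ((j + n - 1) mod n)) = z ^ (k * (j + n - 1)) * (z ^ k * cnj z ^ k)"
      using root_power_mod[OF z, of "j + n - 1" k] root_mult_cnj[OF z n, of k] by (simp add: mult.commute)
    also have "\<dots> = cnj z ^ k * z ^ (k * (j + n - 1) + k)" by (simp add: power_add)
    also have "k * (j + n - 1) + k = k * j + n * k" using n by (cases n) (simp_all add: algebra_simps)
    also have "z ^ \<dots> = z ^ (k * j)"
      using root_power_eq_1_iff[OF z n, of "n * k"] by (simp add: power_add)
    finally show ?thesis .
  qed
  have "Delta_op n (fourier_form n z k) = (\<Sum>j<n. Const (z ^ (k * j)) * Var ((j + 1) mod n))"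
    using derivation_Delta_op
    by (simp add: fourier_form_def derivation_sum derivation_scale Delta_op_Var)
  also have "\<dots> = (\<Sum>j<n. Const (z ^ (k * ((j + n - 1) mod n))) * Var j)"
    using n
    by (intro sum.reindex_bij_witness[of _ "\<lambda>j. (j + n - 1) mod n" "\<lambda>j. (j + 1) mod n"])
       (use mod_shift_cancel[of _ n 1] in auto)
  finally show ?thesis by (simp only: root) (simp add: fourier_form_def Const_mult sum_distrib_left mult.assoc)
qed

lemma Var_eq_fourier_sum:
  assumes z: "primitive_root_of_unity n z" and j: "j < n"
  shows "Var j = (\<Sum>k<n. Const (cnj z ^ (k * j) / of_nat n) * fourier_form n z k)"
proof -
  have "(\<Sum>k<n. Const (cnj z ^ (k * j) / of_nat n) * fourier_form n z k) =
      (\<Sum>k<n. \<Sum>i<n. Const (cnj z ^ (k * j) / of_nat n * z ^ (k * i)) * Var i)"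
    by (simp only: fourier_form_def sum_distrib_left Const_mult mult.assoc)
  also have "\<dots> = (\<Sum>i<n. \<Sum>k<n. Const (cnj z ^ (k * j) / of_nat n * z ^ (k * i)) * Var i)"
    by (rule sum.swap)
  also have "\<dots> = (\<Sum>i<n. Const ((\<Sum>k<n. z ^ (k * i) * cnj z ^ (k * j)) / of_nat n) * Var i)"
    by (simp add: sum_divide_distrib Const_sum sum_distrib_left mult.commute)
  also have "\<dots> = (\<Sum>i<n. if i = j then Var i else 0)"
    using j by (intro sum.cong) (simp_all add: root_orthogonality[OF z])
  finally show ?thesis using j by simp
qed

text \<open>
  By Fourier inversion each variable is a linear combination of the eigenvectors \<open>fourier_form n z k\<close>,
  and the span of the simultaneous eigenvectors is a subalgebra.
\<close>

lemma poly_ring_subset_conj_eigen_span: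
  assumes z: "primitive_root_of_unity n z" and n: "n > 0"
  shows "poly_ring n \<subseteq> conj_eigen_span (D_op n) (Delta_op n)"
proof (rule poly_ring_subset_subalgebra)
  let ?S = "conj_eigen_span (D_op n) (Delta_op n)"
  show S: "is_subalgebra ?S"
    by (intro is_subalgebra_conj_eigen_span derivation_D_op derivation_Delta_op)
  have "conj_eigenvector (D_op n) (Delta_op n) (fourier_form n z k)" for k
    unfolding conj_eigenvector_def
    by (rule exI[of _ "z ^ k"]) (simp add: D_op_fourier_form Delta_op_fourier_form z n)
  then have F: "fourier_form n z k \<in> ?S" for k by (rule conj_eigen_span_single)
  have "(\<Sum>k<m. Const (c k) * fourier_form n z k) \<in> ?S" for c and m :: nat
  proof (induction m)
    case (Suc m)
    moreover have "Const (c m) * fourier_form n z m \<in> ?S"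
      using S F[of m] unfolding is_subalgebra_def by blast
    ultimately show ?case by (simp add: conj_eigen_span_add)
  qed (simp add: conj_eigen_span.zero)
  then show "Var j \<in> ?S" if "j < n" for j
    unfolding Var_eq_fourier_sum[OF z that] .
qed

lemma ker_D_eq_ker_Delta:
  assumes z: "primitive_root_of_unity n z" and n: "n > 0"
  shows "ker_D n = ker_Delta n"
proof -
  have "D_op n f = 0 \<longleftrightarrow> Delta_op n f = 0" if "f \<in> poly_ring n" for f
    using poly_ring_subset_conj_eigen_span[OF z n] that
      kernel_subset_on_span[OF derivation_D_op derivation_Delta_op]
      kernel_subset_on_span[OF derivation_Delta_op derivation_D_op] conj_eigen_span_sym
    by blast
  then show ?thesis by (auto simp: ker_D_def ker_Delta_def)
qed

lemma prod_fourier_form_in_ker_D: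
  assumes z: "primitive_root_of_unity n z" and n: "n > 0" and "(\<Sum>i\<in>I. z ^ k i) = 0"
  shows "(\<Prod>i\<in>I. fourier_form n z (k i)) \<in> ker_D n"
proof -
  have "D_op n (\<Prod>i\<in>I. fourier_form n z (k i)) =
      Const (\<Sum>i\<in>I. z ^ k i) * (\<Prod>i\<in>I. fourier_form n z (k i))"
    by (intro eigenvector_prod derivation_D_op D_op_fourier_form z n)
  with assms(3) show ?thesis
    by (simp add: ker_D_def poly_ring_prod fourier_form_in_poly_ring)
qed

text \<open>
  The eigenvalues of the circulant matrix are discrete Fourier sums of order \<open>p\<close> over the residue
  \<open>t\<close>, and \<open>y_form n z p i t\<close> is a partial Fourier sum over the indices congruent to \<open>t\<close> modulo \<open>p\<close>.
  Writing an index as \<open>t + p * l\<close> merges the two into one Fourier sum of order \<open>n\<close>: multiplication by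
  \<open>z ^ (m * (n div p) * p * l) = 1\<close> is invisible, so the twist of the outer sum shifts the frequency
  from \<open>i\<close> to \<open>i + m * (n div p)\<close>.
\<close>

lemma circulant_y_form_eq_prod:
  assumes z: "primitive_root_of_unity n z" and n: "n > 0" and p: "p dvd n"
  shows "circulant_det p (y_form n z p i) = (\<Prod>m<p. fourier_form n z (i + m * (n div p)))"
proof -
  have p0: "p > 0" using p n by (auto intro: Nat.gr0I)
  let ?N = "n div p"
  have N: "p * ?N = n" using p by simp
  have "(\<Sum>t<p. Const ((z ^ ?N) ^ (m * t)) * y_form n z p i t) = fourier_form n z (i + m * ?N)" for m
  proof -
    have pow: "(z ^ ?N) ^ (m * t) * z ^ (i * (t + p * l)) = z ^ ((i + m * ?N) * (t + p * l))" for t l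
    proof -
      have "(i + m * ?N) * (t + p * l) = ?N * (m * t) + i * (t + p * l) + (p * ?N) * (m * l)"
        by (simp add: algebra_simps)
      moreover have "z ^ ((p * ?N) * (m * l)) = 1"
        unfolding N using root_power_eq_1_iff[OF z n] by simp
      ultimately show ?thesis by (simp only: power_add) (simp flip: power_mult)
    qed
    have "(\<Sum>t<p. Const ((z ^ ?N) ^ (m * t)) * y_form n z p i t) =
        (\<Sum>t<p. \<Sum>l<?N. Const (z ^ ((i + m * ?N) * (t + p * l))) * Var (t + p * l))"
      unfolding y_form_def sum_distrib_left
      by (simp only: pow flip: mult.assoc Const_mult)
    also have "\<dots> = (\<Sum>(t, l)\<in>{..<p} \<times> {..<?N}. Const (z ^ ((i + m * ?N) * (t + p * l))) * Var (t + p * l))"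
      by (simp add: sum.cartesian_product)
    also have "\<dots> = fourier_form n z (i + m * ?N)"
      unfolding fourier_form_def
    proof (rule sum.reindex_bij_witness[of _ "\<lambda>k. (k mod p, k div p)" "\<lambda>(t, l). t + p * l"])
      fix a assume "a \<in> {..<p} \<times> {..<?N}"
      then obtain t l where a: "a = (t, l)" "t < p" "l < ?N" by auto
      have "t + p * l < p * Suc l" using a by simp
      also have "\<dots> \<le> p * ?N" using a by (intro mult_le_mono2) simp
      finally show "(case a of (t, l) \<Rightarrow> t + p * l) \<in> {..<n}" using a N by simp
    next
      fix k assume "k \<in> {..<n}"
      then show "(k mod p, k div p) \<in> {..<p} \<times> {..<?N}"
        using p0 N by (auto simp: less_mult_imp_div_less mult.commute)
    qed (use p0 in auto)
    finally show ?thesis .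
  qed
  then show ?thesis
    using circulant_det_eq_prod[OF primitive_root_power[OF z n p] p0] by simp
qed

text \<open>
  The Fourier forms are coordinates on affine space, so a point may be prescribed by their values.
  The explicit \<open>x\<close> in the proof is the inverse Fourier transform of \<open>w\<close>.
\<close>

lemma fourier_interpolation:
  assumes z: "primitive_root_of_unity n z" and n: "n > 0"
    and w: "\<And>k. w (k mod n) = w k"
  obtains x where "\<And>k. poly_eval x (fourier_form n z k) = w k"
proof
  define x where "x j = (\<Sum>i<n. cnj z ^ (j * i) * w i) / of_nat n" for j
  fix k
  have "poly_eval x (fourier_form n z k) = (\<Sum>j<n. z ^ (k * j) * x j)"
    by (simp add: fourier_form_def poly_eval_sum poly_eval_mult)
  also have "\<dots> = (\<Sum>j<n. \<Sum>i<n. z ^ (j * (k mod n)) * cnj z ^ (j * i) * w i / of_nat n)"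
    using root_power_mod[OF z, of k]
    by (simp add: x_def sum_distrib_left sum_divide_distrib mult.assoc mult.commute[of _ "k mod n"])
  also have "\<dots> = (\<Sum>i<n. \<Sum>j<n. z ^ (j * (k mod n)) * cnj z ^ (j * i) * w i / of_nat n)"
    by (rule sum.swap)
  also have "\<dots> = (\<Sum>i<n. (\<Sum>j<n. z ^ (j * (k mod n)) * cnj z ^ (j * i)) * w i / of_nat n)"
    by (simp add: sum_distrib_right sum_divide_distrib)
  also have "\<dots> = (\<Sum>i<n. if k mod n = i then w i else 0)"
    using n by (intro sum.cong) (simp_all add: root_orthogonality[OF z])
  also have "\<dots> = w k" using n w by simp
  finally show "poly_eval x (fourier_form n z k) = w k" .
qed

section \<open>A vanishing sum of roots of unity that is not a union of polygons\<close>

lemma dvd_mult_div_iff: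
  fixes n d x :: nat
  assumes "n > 0" "d dvd n"
  shows "n dvd x * (n div d) \<longleftrightarrow> d dvd x"
proof -
  from assms obtain m where "n = d * m" "d > 0" "m > 0" by (auto elim: dvdE)
  then show ?thesis by simp
qed

text \<open>
  The residue classes of nonzero \<open>k\<close> whose order in the integers modulo \<open>n\<close> divides \<open>d\<close> or \<open>r\<close>,
  that is, \<open>z ^ k \<noteq> 1\<close> is a \<open>d\<close>-th or an \<open>r\<close>-th root of unity. With \<open>d = p * q\<close> this set contains
  all indices that occur in the vanishing sum \<open>A\<^sub>p A\<^sub>q + A\<^sub>r\<close>. It is larger than the set of those indices,
  but being defined by divisibility alone it is easier to test, and the separation argument
  works for it just as well.
\<close>

definition two_type_index :: "nat \<Rightarrow> nat \<Rightarrow> nat \<Rightarrow> nat \<Rightarrow> bool" where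
  "two_type_index n d r k \<longleftrightarrow> \<not> n dvd k \<and> (n dvd d * k \<or> n dvd r * k)"

lemma two_type_index_mod: "two_type_index n d r (k mod n) = two_type_index n d r k"
  by (simp add: two_type_index_def dvd_eq_mod_eq_0 mod_simps)

lemma two_type_index_polygon_pair:
  assumes n: "n > 0" and p: "prime p" "p dvd n" and q: "prime q" "q dvd n" and "p \<noteq> q"
    and a: "0 < a" "a < p"
  shows "two_type_index n (p * q) r (a * (n div p) + b * (n div q))"
proof -
  have "\<not> n dvd a * (n div p) + b * (n div q)"
  proof
    assume "n dvd a * (n div p) + b * (n div q)"
    then have "n dvd q * (a * (n div p) + b * (n div q))" by (rule dvd_mult)
    also have "q * (a * (n div p) + b * (n div q)) = (q * a) * (n div p) + b * n"
      using q by (auto simp: algebra_simps elim!: dvdE)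
    finally have "p dvd q * a"
      using dvd_mult_div_iff[OF n p(2)] by (simp add: dvd_add_left_iff)
    with p q a \<open>p \<noteq> q\<close> show False
      by (metis nat_dvd_not_less prime_dvd_mult_iff primes_dvd_imp_eq)
  qed
  moreover have "n dvd (p * q) * (a * (n div p) + b * (n div q))"
  proof -
    have "(p * q) * (a * (n div p) + b * (n div q)) =
        q * a * (p * (n div p)) + p * b * (q * (n div q))"
      by (simp only: algebra_simps)
    then show ?thesis using p q by simp
  qed
  ultimately show ?thesis by (simp add: two_type_index_def)
qed

lemma two_type_index_polygon:
  assumes "n > 0" "r dvd n" "0 < c" "c < r"
  shows "two_type_index n d r (c * (n div r))"
proof -
  have "r * (c * (n div r)) = c * n" using assms by (auto elim!: dvdE)
  with assms show ?thesis
    by (auto simp: two_type_index_def dvd_mult_div_iff nat_dvd_not_less)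
qed

text \<open>
  A coset of the subgroup of order \<open>l\<close> through \<open>n div r\<close> always leaves the set. If \<open>l = r\<close>, the coset
  is the subgroup itself and contains \<open>0\<close>. Otherwise it contains \<open>n div r + n div l\<close>, an element of
  order \<open>r * l\<close>, which divides neither \<open>r\<close> nor the number \<open>d\<close> coprime to \<open>r\<close>.
\<close>

lemma coset_leaves_two_type_index:
  assumes n: "n > 0" and l: "prime l" "l dvd n" and r: "prime r" "r dvd n" and "coprime r d"
    and s: "(i + m * (n div l)) mod n = n div r"
  shows "\<exists>m'<l. \<not> two_type_index n d r (i + m' * (n div l))"
proof -
  have l0: "l > 0" "r > 0" using l r prime_gt_0_nat by auto
  \<comment> \<open>Moving \<open>c\<close> steps along the coset from \<open>n div r\<close>, with the position reduced modulo \<open>l\<close>.\<close>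
  have move: "two_type_index n d r (i + (m + c) mod l * (n div l)) =
      two_type_index n d r (n div r + c * (n div l))" for c
  proof -
    have "(m + c) mod l * (n div l) = ((m + c) * (n div l)) mod n"
      using l by (simp add: mult_mod_left)
    then have "(i + (m + c) mod l * (n div l)) mod n = (i + (m + c) * (n div l)) mod n"
      by (simp add: mod_simps)
    also have "\<dots> = ((i + m * (n div l)) mod n + c * (n div l)) mod n"
      by (simp add: mod_simps algebra_simps)
    finally show ?thesis using s two_type_index_mod by metis
  qed
  have "\<exists>c. \<not> two_type_index n d r (n div r + c * (n div l))"
  proof (cases "l = r")
    case True
    have "n div r + (r - 1) * (n div r) = r * (n div r)" using l0 by (cases r) simp_all
    with r True have "n dvd n div r + (r - 1) * (n div l)" by simp
    then show ?thesis unfolding two_type_index_def by blast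
  next
    case False
    have "\<not> n dvd d * (n div r + n div l)"
    proof
      assume "n dvd d * (n div r + n div l)"
      then have "n dvd l * (d * (n div r + n div l))" by (rule dvd_mult)
      also have "l * (d * (n div r + n div l)) = (l * d) * (n div r) + d * n"
        using l by (auto simp: algebra_simps elim!: dvdE)
      finally have "r dvd l * d" using dvd_mult_div_iff[OF n r(2)] by (simp add: dvd_add_left_iff)
      then have "r dvd l" using \<open>coprime r d\<close> by (simp add: coprime_dvd_mult_left_iff)
      with l r False show False using primes_dvd_imp_eq by blast
    qed
    moreover have "\<not> n dvd r * (n div r + n div l)"
    proof
      assume "n dvd r * (n div r + n div l)"
      also have "r * (n div r + n div l) = n + r * (n div l)" using r by (simp add: distrib_left)
      finally have "l dvd r" using dvd_mult_div_iff[OF n l(2)] by (simp add: dvd_add_right_iff)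
      with l r False show False using primes_dvd_imp_eq by blast
    qed
    ultimately have "\<not> two_type_index n d r (n div r + 1 * (n div l))"
      by (simp add: two_type_index_def)
    then show ?thesis by blast
  qed
  then obtain c where "\<not> two_type_index n d r (i + (m + c) mod l * (n div l))"
    unfolding move by blast
  with l0 show ?thesis by (meson mod_less_divisor)
qed

lemma sum_polygon:
  assumes z: "primitive_root_of_unity n z" and n: "n > 0" and p: "prime p" "p dvd n"
  shows "(\<Sum>m<p. z ^ (m * (n div p))) = 0"
    and "(\<Sum>m\<in>{1..<p}. z ^ (m * (n div p))) = - 1"
proof -
  have "p > 1" using p prime_gt_1_nat by blast
  then show *: "(\<Sum>m<p. z ^ (m * (n div p))) = 0"
    using sum_root_powers[OF primitive_root_power[OF z n p(2)], of 1]
    by (simp add: mult.commute flip: power_mult)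
  have "{..<p} = insert 0 {1..<p}" using \<open>p > 1\<close> by auto
  with * show "(\<Sum>m\<in>{1..<p}. z ^ (m * (n div p))) = - 1"
    by (simp add: add_eq_0_iff)
qed

text \<open>
  The terms of the vanishing sum \<open>A\<^sub>p A\<^sub>q + A\<^sub>r\<close>, as a formal disjoint union: this keeps the sum and the
  product over them free of any question whether two terms have the same index.
\<close>

definition polygon_pair_vertices :: "nat \<Rightarrow> nat \<Rightarrow> nat \<Rightarrow> (nat \<times> nat + nat) set" where
  "polygon_pair_vertices p q r = ({1..<p} \<times> {1..<q}) <+> {1..<r}"

definition vertex_index :: "nat \<Rightarrow> nat \<Rightarrow> nat \<Rightarrow> nat \<Rightarrow> nat \<times> nat + nat \<Rightarrow> nat" where
  "vertex_index n p q r =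
     case_sum (\<lambda>(a, b). a * (n div p) + b * (n div q)) (\<lambda>c. c * (n div r))"

lemma sum_polygon_pair_vertices:
  assumes z: "primitive_root_of_unity n z" and n: "n > 0"
    and p: "prime p" "p dvd n" and q: "prime q" "q dvd n" and r: "prime r" "r dvd n"
  shows "(\<Sum>v\<in>polygon_pair_vertices p q r. z ^ vertex_index n p q r v) = 0"
proof -
  have "(\<Sum>(a, b)\<in>{1..<p} \<times> {1..<q}. z ^ (a * (n div p) + b * (n div q))) =
      (\<Sum>a\<in>{1..<p}. z ^ (a * (n div p))) * (\<Sum>b\<in>{1..<q}. z ^ (b * (n div q)))"
    by (simp add: sum_product power_add sum.cartesian_product)
  also have "\<dots> = 1" using sum_polygon(2)[OF z n] p q by simp
  finally show ?thesis
    using sum_polygon(2)[OF z n r]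
    by (simp add: polygon_pair_vertices_def vertex_index_def sum.Plus case_prod_unfold)
qed

text \<open>
  The points \<open>x\<close> and \<open>y\<close> differ only in the Fourier coordinate with index \<open>n div r\<close>. A generator that
  involves this coordinate also involves one that is \<open>0\<close> at both points, so the points agree on all
  generators and hence on the whole subalgebra. The product takes the values \<open>1\<close> and \<open>0\<close>.
\<close>

lemma witness_not_generated:
  assumes z: "primitive_root_of_unity n z" and n: "n > 0"
    and p: "prime p" "p dvd n" and q: "prime q" "q dvd n" and r: "prime r" "r dvd n"
    and ne: "p \<noteq> q" "p \<noteq> r" "q \<noteq> r"
  shows "(\<Prod>v\<in>polygon_pair_vertices p q r. fourier_form n z (vertex_index n p q r v))
     \<notin> generated_subalgebra
         {circulant_det l (y_form n z l i) | l i. l \<in> prime_factors n \<and> i < n div l}"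
    (is "?W \<notin> generated_subalgebra ?G")
proof -
  let ?T = "two_type_index n (p * q) r"
  have cop: "coprime r (p * q)" using p q r ne by (auto simp: primes_coprime)
  obtain x where x: "\<And>k. poly_eval x (fourier_form n z k) = of_bool (?T k)"
    using fourier_interpolation[OF z n, of "\<lambda>k. of_bool (?T k)"] by (auto simp: two_type_index_mod)
  obtain y where y: "\<And>k. poly_eval y (fourier_form n z k) = of_bool (?T k \<and> k mod n \<noteq> n div r)"
    using fourier_interpolation[OF z n, of "\<lambda>k. of_bool (?T k \<and> k mod n \<noteq> n div r)"]
    by (auto simp: two_type_index_mod)
  define B where "B = {f. poly_eval x f = poly_eval y f}"
  have "is_subalgebra B"
    by (auto simp: is_subalgebra_def B_def poly_eval_add poly_eval_mult)
  moreover have "?G \<subseteq> B"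
  proof clarify
    fix l i assume "l \<in> prime_factors n"
    then have l: "prime l" "l dvd n" by auto
    have "(\<Prod>m<l. of_bool (?T (i + m * (n div l)))) =
        (\<Prod>m<l. of_bool (?T (i + m * (n div l)) \<and> (i + m * (n div l)) mod n \<noteq> n div r) :: complex)"
    proof (cases "\<exists>m<l. (i + m * (n div l)) mod n = n div r")
      case True
      then obtain m' where "m' < l" "\<not> ?T (i + m' * (n div l))"
        using coset_leaves_two_type_index[OF n l r cop] by blast
      then show ?thesis
        by (subst (1 2) prod_zero[of "{..<l}"]) auto
    next
      case False
      then show ?thesis by (intro prod.cong) auto
    qed
    then show "circulant_det l (y_form n z l i) \<in> B"
      by (simp add: B_def circulant_y_form_eq_prod[OF z n l(2)] poly_eval_prod x y)
  qed
  ultimately have "generated_subalgebra ?G \<subseteq> B"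
    unfolding generated_subalgebra_def by (intro hull_minimal)
  moreover have "?W \<notin> B"
  proof -
    have "?T (vertex_index n p q r v)" if "v \<in> polygon_pair_vertices p q r" for v
      using that two_type_index_polygon_pair[OF n p q ne(1)] two_type_index_polygon[OF n r(2)]
      by (auto simp: polygon_pair_vertices_def vertex_index_def)
    then have "poly_eval x ?W = 1" by (simp add: poly_eval_prod x)
    moreover have "poly_eval y ?W = 0"
    proof -
      have "r > 1" using r prime_gt_1_nat by blast
      then have v: "Inr 1 \<in> polygon_pair_vertices p q r" "n div r < n"
        using n by (auto simp: polygon_pair_vertices_def)
      have "finite (polygon_pair_vertices p q r)" by (simp add: polygon_pair_vertices_def)
      then show ?thesis
        using v by (auto simp: poly_eval_prod y vertex_index_def intro!: prod_zero bexI[of _ "Inr 1"])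
    qed
    ultimately show ?thesis by (simp add: B_def)
  qed
  ultimately show ?thesis by blast
qed

theorem theorem3:
  fixes n :: nat and z :: complex
  assumes "n > 0"
    and "card (prime_factors n) \<ge> 3"
    and "primitive_root_of_unity n z"
  shows "ker_D n = ker_Delta n \<and>
         generated_subalgebra
           {circulant_det p (y_form n z p i) | p i. p \<in> prime_factors n \<and> i < n div p}
         \<subset> ker_Delta n"
proof -
  note n = assms(1) and z = assms(3)
  let ?G = "{circulant_det p (y_form n z p i) | p i. p \<in> prime_factors n \<and> i < n div p}"
  have "?G \<subseteq> ker_D n"
  proof clarify
    fix p i assume "p \<in> prime_factors n"
    then have p: "prime p" "p dvd n" by auto
    have "(\<Sum>m<p. z ^ (i + m * (n div p))) = 0"
      using sum_polygon(1)[OF z n p] by (simp add: power_add flip: sum_distrib_left)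
    then show "circulant_det p (y_form n z p i) \<in> ker_D n"
      unfolding circulant_y_form_eq_prod[OF z n p(2)] by (rule prod_fourier_form_in_ker_D[OF z n])
  qed
  then have sub: "generated_subalgebra ?G \<subseteq> ker_D n"
    unfolding generated_subalgebra_def by (intro hull_minimal is_subalgebra_ker_D)
  obtain P where "P \<subseteq> prime_factors n" "card P = 3"
    using assms(2) obtain_subset_with_card_n by metis
  then obtain p q r where "p \<noteq> q" "p \<noteq> r" "q \<noteq> r" "{p, q, r} \<subseteq> prime_factors n"
    by (auto simp: card_3_iff)
  then have pqr: "prime p" "p dvd n" "prime q" "q dvd n" "prime r" "r dvd n"
      "p \<noteq> q" "p \<noteq> r" "q \<noteq> r"
    by auto
  have "generated_subalgebra ?G \<noteq> ker_D n"
    using witness_not_generated[OF z n pqr]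
      prod_fourier_form_in_ker_D[OF z n sum_polygon_pair_vertices[OF z n pqr(1-6)]] by blast
  with sub ker_D_eq_ker_Delta[OF z n] show ?thesis by blast
qed

end
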